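(* Let $k\in\mathbb{N}$, let $t\ge 0$ and put $x=1-2e^{-t}$. The generating function $B_k(z,t):=\sum_{n=k}^\infty\tau_k^n(t)\,z^{n+1}$ of the de Branges functions has, for $z\in\mathbb{D}$, the representation $$B_k(z,t)=\sum_{n=k}^\infty\tau_k^n(t)\,z^{n+1}=K(z)\,w(z,t)^k=K(z)\left(\frac{4e^{-t}z}{\left(1-z+\sqrt{1-2xz+z^2}\right)^2}\right)^k.$$ Moreover, one has the hypergeometric representation $$B_k(z,t)=K(z)^{k+1}e^{-kt}\;{}_2F_1\!\left(k,\,k+\tfrac12;\,2k+1;\,-4K(z)e^{-t}\right)=\sum_{j=k}^\infty(-1)^{j+k}\,\frac{2k}{j+k}\binom{2j-1}{j-k}K(z)^{j+1}e^{-jt},$$ the last series being a Taylor series representation with respect to $y=e^{-t}=\frac{1-x}{2}$.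
   Context: $\mathbb{N}=\{1,2,3,\ldots\}$; a dot denotes the derivative with respect to $t$; $\mathbb{D}$ is the open unit disk in $\mathbb{C}$. De Branges functions: for fixed $n\in\mathbb{N}$, the functions $\tau_k^n:[0,\infty)\to\mathbb{R}$ $(k=1,\ldots,n+1)$ are the solution of the system of differential equations $$\tau_{k+1}^n(t)-\tau_k^n(t)=\frac{\dot\tau_k^n(t)}{k}+\frac{\dot\tau_{k+1}^n(t)}{k+1}\quad (k=1,\ldots,n),\qquad \tau_{n+1}^n\equiv 0,$$ with initial values $\tau_k^n(0)=n+1-k$. $K(z)=\frac{z}{(1-z)^2}$ is the Koebe function, which is injective on $\mathbb{D}$, and $w(z,t):=K^{-1}\big(e^{-t}K(z)\big)\in\mathbb{D}$ for $z\in\mathbb{D}$, $t\ge 0$ (i.e. $w(z,t)$ is the unique point of $\mathbb{D}$ with $K(w(z,t))=e^{-t}K(z)$). $\sqrt{1-2xz+z^2}$ denotes the branch analytic in $z\in\mathbb{D}$ with value $1$ at $z=0$. ${}_2F_1(a,b;c;u)=\sum_{m\ge 0}\frac{(a)_m(b)_m}{(c)_m\,m!}u^m$ for $|u|<1$, with $(a)_m=a(a+1)\cdots(a+m-1)$, continued analytically to $\mathbb{C}\setminus[1,\infty)$. The final series in powers of $y=e^{-t}$ is the Taylor series in $y$ about $y=0$ (for fixed $z$), and its equality with $B_k(z,t)$ is understood where it converges as such, i.e. for $|4K(z)e^{-t}|<1$. *)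

theory Defs
  imports "HOL-Complex_Analysis.Complex_Analysis"
begin

text \<open>
  The value \<open>T k t\<close> stands for \<open>\<tau>\<^sub>k\<^sup>n(t)\<close>. Only the indices \<open>1 \<le> k \<le> n + 1\<close> and the times
  \<open>t \<ge> 0\<close> are constrained; at \<open>t = 0\<close> the derivative is one-sided.
\<close>

definition de_branges_system :: "nat \<Rightarrow> (nat \<Rightarrow> real \<Rightarrow> real) \<Rightarrow> bool" where
  "de_branges_system n T \<longleftrightarrow>
     (\<exists>T'. (\<forall>k\<in>{1..n+1}. \<forall>t\<ge>0. (T k has_real_derivative T' k t) (at t within {0..})) \<and>
           (\<forall>k\<in>{1..n}. \<forall>t\<ge>0.
              T (k+1) t - T k t = T' k t / real k + T' (k+1) t / real (k+1))) \<and>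
     (\<forall>t\<ge>0. T (n+1) t = 0) \<and>
     (\<forall>k\<in>{1..n+1}. T k 0 = real n + 1 - real k)"

text \<open>
  A solution is unique only as a family of functions on \<open>[0,\<infinity>)\<close>, so the description is applied
  to its values. Meaningful for \<open>1 \<le> k \<le> n + 1\<close> and \<open>t \<ge> 0\<close>.
\<close>

definition de_branges :: "nat \<Rightarrow> nat \<Rightarrow> real \<Rightarrow> real" where
  "de_branges n k t = (THE v. \<exists>T. de_branges_system n T \<and> v = T k t)"

definition de_branges_term :: "nat \<Rightarrow> complex \<Rightarrow> real \<Rightarrow> nat \<Rightarrow> complex" where
  "de_branges_term k z t n = of_real (de_branges n k t) * z ^ (n + 1)"

text \<open>The summation index \<open>n \<ge> k\<close> is written as \<open>i + k\<close>.\<close>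

definition de_branges_gen :: "nat \<Rightarrow> complex \<Rightarrow> real \<Rightarrow> complex" where
  "de_branges_gen k z t = (\<Sum>i. de_branges_term k z t (i + k))"

definition koebe :: "complex \<Rightarrow> complex" where
  "koebe z = z / (1 - z)\<^sup>2"

definition koebe_flow :: "complex \<Rightarrow> real \<Rightarrow> complex" where
  "koebe_flow z t = inv_into (ball 0 1) koebe (of_real (exp (- t)) * koebe z)"

text \<open>
  The branch of \<open>\<surd>(1 - 2xz + z\<^sup>2)\<close> that is analytic in the unit disk with value \<open>1\<close> at the origin.
  It exists for \<open>-1 \<le> x \<le> 1\<close>.
\<close>

definition legendre_sqrt :: "real \<Rightarrow> complex \<Rightarrow> complex" where
  "legendre_sqrt x z =
     (THE v. \<exists>r. r holomorphic_on ball 0 1 \<and> r 0 = 1 \<and>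
                 (\<forall>u\<in>ball 0 1. (r u)\<^sup>2 = 1 - 2 * of_real x * u + u\<^sup>2) \<and>
                 v = r z)"

text \<open>
  The Gauss hypergeometric function, continued analytically from the unit disk to the plane cut
  along \<open>[1,\<infinity>)\<close>.
\<close>

definition hyp2F1 :: "complex \<Rightarrow> complex \<Rightarrow> complex \<Rightarrow> complex \<Rightarrow> complex" where
  "hyp2F1 a b c u =
     (THE v. \<exists>F. F holomorphic_on - (complex_of_real ` {1..}) \<and>
                 (\<forall>s\<in>ball 0 1.
                    (\<lambda>m. pochhammer a m * pochhammer b m / (pochhammer c m * fact m) * s ^ m)
                      sums F s) \<and>
                 v = F u)"

text \<open>
  The coefficient of \<open>y\<^sup>j\<close>, \<open>j \<ge> k\<close>, in the expansion of the generating function at \<open>z\<close>. The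
  subtraction \<open>2 * j - 1\<close> on the naturals does not truncate, as \<open>j \<ge> k \<ge> 1\<close>.
\<close>

definition gen_coeff :: "nat \<Rightarrow> complex \<Rightarrow> nat \<Rightarrow> complex" where
  "gen_coeff k z j =
     (-1) ^ (j + k) * (2 * of_nat k / of_nat (j + k)) * of_nat ((2 * j - 1) choose (j - k))
       * koebe z ^ (j + 1)"

end

theory Submission
  imports Defs
begin

text \<open>
  On the plane cut along \<open>(-\<infinity>, -1/4]\<close> the Koebe function has the explicit inverse
  \<open>(s - 1) / (s + 1)\<close> with \<open>s = \<surd>(1 + 4u)\<close>. Its power series \<open>w\<close> satisfies \<open>w = X (1 - w)\<^sup>2\<close>, hence
  \<open>X w' (1 + w) = w (1 - w)\<close>. For the coefficients \<open>c\<^sub>k\<^sub>j\<close> of \<open>w\<^sup>k\<close> this says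
  \<open>c\<^sub>k\<^sub>+\<^sub>1\<^sub>j - c\<^sub>k\<^sub>j = - j (c\<^sub>k\<^sub>j / k + c\<^sub>k\<^sub>+\<^sub>1\<^sub>j / (k + 1))\<close>, which is the de Branges system for each
  exponential \<open>e\<^sup>-\<^sup>j\<^sup>t\<close> separately. So the coefficient of \<open>z\<^sup>n\<^sup>+\<^sup>1\<close> in \<open>K(z) w(e\<^sup>-\<^sup>t K(z))\<^sup>k\<close>, as a function
  of \<open>t\<close>, solves the system; at \<open>t = 0\<close> the function is \<open>K(z) z\<^sup>k\<close>, which gives the initial values.
  The system is triangular and has only one solution. Read downwards in \<open>k\<close> from \<open>c\<^sub>j\<^sub>j = 1\<close>, the
  same recurrence yields the closed form of \<open>c\<^sub>k\<^sub>j\<close>.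
\<close>

section \<open>Explicit inverse of the Koebe function on the slit plane\<close>

text \<open>This is the image of the unit disk under \<open>koebe\<close>. Stating the condition on
  \<open>1 + 4 * u\<close> keeps the argument of \<open>csqrt\<close> off its branch cut.\<close>

definition koebe_dom :: "complex set" where
  "koebe_dom = {u. 1 + 4 * u \<notin> \<real>\<^sub>\<le>\<^sub>0}"

definition koebe_inv :: "complex \<Rightarrow> complex" where
  "koebe_inv u = (csqrt (1 + 4 * u) - 1) / (csqrt (1 + 4 * u) + 1)"

text \<open>A principal root with real part 0 is purely imaginary, so its square is a nonpositive
  real.\<close>

lemma Re_csqrt_pos:
  assumes "v \<notin> \<real>\<^sub>\<le>\<^sub>0"
  shows "Re (csqrt v) > 0"
proof (rule ccontr)
  assume "\<not> ?thesis"
  then have "Re (csqrt v) = 0"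
    using Re_csqrt[of v] by linarith
  then have "csqrt v = \<i> * of_real (Im (csqrt v))"
    by (simp add: complex_eq_iff del: csqrt.simps)
  then have "(csqrt v)\<^sup>2 = of_real (- (Im (csqrt v))\<^sup>2)"
    by (metis mult_minus1 of_real_minus of_real_power power_mult_distrib power2_i)
  then have "v = of_real (- (Im (csqrt v))\<^sup>2)"
    by (simp del: csqrt.simps)
  moreover have "complex_of_real (- (Im (csqrt v))\<^sup>2) \<in> \<real>\<^sub>\<le>\<^sub>0"
    by (simp only: nonpos_Reals_of_real_iff) simp
  ultimately show False
    using assms by metis
qed

lemma one_plus_csqrt_neq_0: "v \<notin> \<real>\<^sub>\<le>\<^sub>0 \<Longrightarrow> 1 + csqrt v \<noteq> 0"
  using Re_csqrt_pos[of v] by (auto simp: complex_eq_iff simp del: csqrt.simps)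

lemma zero_in_koebe_dom [simp]: "0 \<in> koebe_dom"
  by (simp add: koebe_dom_def)

lemma open_koebe_dom: "open koebe_dom"
proof -
  have "koebe_dom = (\<lambda>u. 1 + 4 * u) -` (- \<real>\<^sub>\<le>\<^sub>0)"
    by (auto simp: koebe_dom_def)
  moreover have "open ((\<lambda>u::complex. 1 + 4 * u) -` (- \<real>\<^sub>\<le>\<^sub>0))"
    by (intro open_vimage continuous_intros) (simp add: open_Compl)
  ultimately show ?thesis
    by simp
qed

lemma ball_subset_koebe_dom:
  assumes "norm (4 * u) < 1"
  shows "u \<in> koebe_dom"
proof -
  have "Re (- (4 * u)) < 1"
    using complex_Re_le_cmod[of "- (4 * u)"] assms by simp
  then show ?thesis
    by (auto simp: koebe_dom_def complex_nonpos_Reals_iff)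
qed

text \<open>The slit plane is starlike about 0. This keeps \<open>exp (- t) * koebe z\<close> in the
  image of the disk for all t \<ge> 0.\<close>

lemma koebe_dom_scale:
  assumes "u \<in> koebe_dom" "0 \<le> r" "r \<le> 1"
  shows "of_real r * u \<in> koebe_dom"
proof -
  \<comment> \<open>This settles real \<open>u\<close>; a nonreal \<open>u\<close> stays nonreal
    unless \<open>r = 0\<close>, and then the scaled point is 0.\<close>
  have "1 + 4 * Re u * r > 0" if "1 + 4 * Re u > 0"
  proof (cases "Re u \<ge> 0")
    case False
    then have "Re u * 1 \<le> Re u * r"
      using assms by (intro mult_left_mono_neg) auto
    then show ?thesis using that by linarith
  qed (use assms in \<open>auto intro!: add_pos_nonneg\<close>)
  then show ?thesis
    using assms by (cases "r = 0") (auto simp: koebe_dom_def complex_nonpos_Reals_iff mult_ac)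
qed

lemma koebe_inv_holomorphic: "koebe_inv holomorphic_on koebe_dom"
  unfolding koebe_inv_def
  using one_plus_csqrt_neq_0
  by (intro holomorphic_intros) (auto simp: koebe_dom_def add.commute)

text \<open>Expand the fraction by s + 1 and use (s - 1)(s + 1) = 4u. With \<open>u\<close> as a
  visible factor, this form leads to both the square-root and the hypergeometric
  representation.\<close>

lemma koebe_inv_eq:
  assumes "u \<in> koebe_dom"
  shows "koebe_inv u = 4 * u / (1 + csqrt (1 + 4 * u))\<^sup>2"
proof -
  define s where "s = csqrt (1 + 4 * u)"
  have "1 + s \<noteq> 0" "s\<^sup>2 = 1 + 4 * u"
    using one_plus_csqrt_neq_0 assms by (auto simp: koebe_dom_def s_def)
  moreover from this have "4 * u = (s - 1) * (1 + s)"
    by (simp add: power2_eq_square algebra_simps)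
  ultimately show ?thesis
    unfolding koebe_inv_def s_def[symmetric]
    by (simp add: power2_eq_square add.commute)
qed

text \<open>For w = (s - 1)/(s + 1) one has 1 - w = 2/(s + 1), so K(w) = (s^2 - 1)/4.\<close>

lemma koebe_koebe_inv:
  assumes "u \<in> koebe_dom"
  shows "koebe (koebe_inv u) = u"
proof -
  define s where "s = csqrt (1 + 4 * u)"
  have s: "s + 1 \<noteq> 0" "s\<^sup>2 = 1 + 4 * u"
    using one_plus_csqrt_neq_0 assms by (auto simp: koebe_dom_def s_def add.commute)
  have "1 - (s - 1) / (s + 1) = 2 / (s + 1)"
    using s by (simp add: field_simps)
  then have "koebe (koebe_inv u) = (s - 1) * (s + 1) / 4"
    using s unfolding koebe_inv_def koebe_def s_def[symmetric]
    by (simp add: power2_eq_square)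
  also have "\<dots> = u"
    using s(2) by (simp add: power2_eq_square algebra_simps)
  finally show ?thesis .
qed

text \<open>A point s of the right half-plane is closer to 1 than to -1.\<close>

lemma koebe_inv_in_ball:
  assumes "u \<in> koebe_dom"
  shows "koebe_inv u \<in> ball 0 1"
proof -
  define s where "s = csqrt (1 + 4 * u)"
  have s: "Re s > 0"
    using Re_csqrt_pos assms by (auto simp: koebe_dom_def s_def simp del: csqrt.simps)
  then have "(norm (s - 1))\<^sup>2 < (norm (s + 1))\<^sup>2"
    unfolding cmod_power2 by (simp add: power2_eq_square algebra_simps)
  then have "norm (s - 1) < norm (s + 1)"
    by (rule power2_less_imp_less) simp
  then show ?thesis
    unfolding koebe_inv_def s_def[symmetric] by (simp add: norm_divide divide_less_eq)
qed

text \<open>The two parts together identify (1 + z)/(1 - z) as the principal root of 1 +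
  4K(z).\<close>

lemma one_plus_4_koebe:
  assumes "z \<in> ball 0 1"
  shows "1 + 4 * koebe z = ((1 + z) / (1 - z))\<^sup>2" "Re ((1 + z) / (1 - z)) > 0"
proof -
  have z: "1 - z \<noteq> 0" using assms by auto
  then show "1 + 4 * koebe z = ((1 + z) / (1 - z))\<^sup>2"
    by (simp add: koebe_def field_simps) (simp add: power2_eq_square algebra_simps)
  have "(norm z)\<^sup>2 < 1"
    using assms by (simp add: power_less_one_iff)
  then have "(Re z)\<^sup>2 + (Im z)\<^sup>2 < 1"
    by (simp add: cmod_power2)
  moreover have "(1 - Re z)\<^sup>2 + (Im z)\<^sup>2 > 0"
    using z by (auto simp: complex_eq_iff sum_power2_gt_zero_iff)
  ultimately show "Re ((1 + z) / (1 - z)) > 0"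
    by (simp add: Re_divide power2_eq_square algebra_simps zero_less_divide_iff)
qed

lemma koebe_in_koebe_dom:
  assumes "z \<in> ball 0 1"
  shows "koebe z \<in> koebe_dom"
proof -
  define q where "q = (1 + z) / (1 - z)"
  have "q\<^sup>2 \<notin> \<real>\<^sub>\<le>\<^sub>0"
    using one_plus_4_koebe(2)[OF assms, folded q_def]
    by (auto simp: complex_nonpos_Reals_iff power2_eq_square not_le)
  then show ?thesis
    using one_plus_4_koebe(1)[OF assms, folded q_def] by (simp add: koebe_dom_def)
qed

lemma koebe_inv_koebe:
  assumes "z \<in> ball 0 1"
  shows "koebe_inv (koebe z) = z"
proof -
  have "csqrt (1 + 4 * koebe z) = (1 + z) / (1 - z)"
    using one_plus_4_koebe[OF assms] by (simp add: csqrt_square)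
  moreover have "1 - z \<noteq> 0" using assms by auto
  moreover from this have "(1 + z) / (1 - z) - 1 = 2 * z / (1 - z)"
    "(1 + z) / (1 - z) + 1 = 2 / (1 - z)"
    by (simp_all add: field_simps)
  ultimately show ?thesis
    by (simp add: koebe_inv_def)
qed

text \<open>The left inverse \<open>koebe_inv\<close> makes \<open>koebe\<close> injective on the
  disk, so \<open>inv_into\<close> can only return the preimage that \<open>koebe_inv\<close>
  provides.\<close>

lemma koebe_flow_eq:
  assumes "z \<in> ball 0 1" "t \<ge> 0"
  shows "koebe_flow z t = koebe_inv (of_real (exp (- t)) * koebe z)"
proof -
  have dom: "of_real (exp (- t)) * koebe z \<in> koebe_dom"
    using assms koebe_in_koebe_dom by (intro koebe_dom_scale) auto
  have "inj_on koebe (ball 0 1)"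
    by (rule inj_on_inverseI[of _ koebe_inv]) (rule koebe_inv_koebe)
  then show ?thesis
    unfolding koebe_flow_def
    using koebe_inv_in_ball[OF dom] koebe_koebe_inv[OF dom] inv_into_f_eq by metis
qed

section \<open>Power series of the inverse and the coefficients of its powers\<close>

definition koebe_inv_fps :: "complex fps" where
  "koebe_inv_fps = fps_expansion koebe_inv 0"

lemma koebe_inv_has_fps: "koebe_inv has_fps_expansion koebe_inv_fps"
  unfolding koebe_inv_fps_def
  using has_fps_expansion_fps_expansion[OF open_koebe_dom _ koebe_inv_holomorphic] by simp

text \<open>The equation K(w) = u, cleared of its denominator, holds near 0; uniqueness of
  expansions turns it into an identity of formal series.\<close>

lemma koebe_inv_fps_eq: "koebe_inv_fps = fps_X * (1 - koebe_inv_fps)\<^sup>2"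
proof -
  have ev: "eventually (\<lambda>u. koebe_inv u = u * (1 - koebe_inv u)\<^sup>2) (nhds 0)"
  proof -
    have "eventually (\<lambda>u. u \<in> koebe_dom) (nhds 0)"
      by (intro eventually_nhds_in_open open_koebe_dom) simp
    then show ?thesis
    proof eventually_elim
      case (elim u)
      then have "1 - koebe_inv u \<noteq> 0"
        using koebe_inv_in_ball by fastforce
      then show ?case
        using koebe_koebe_inv[OF elim] by (simp add: koebe_def field_simps)
    qed
  qed
  have "(\<lambda>u. u * (1 - koebe_inv u)\<^sup>2) has_fps_expansion fps_X * (1 - koebe_inv_fps)\<^sup>2"
    by (intro fps_expansion_intros koebe_inv_has_fps)
  then have "koebe_inv has_fps_expansion fps_X * (1 - koebe_inv_fps)\<^sup>2"
    using has_fps_expansion_cong[OF ev refl] by blast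
  then show ?thesis
    using koebe_inv_has_fps fps_expansion_unique_complex by blast
qed

lemma koebe_inv_fps_ode:
  "fps_X * fps_deriv koebe_inv_fps * (1 + koebe_inv_fps) = koebe_inv_fps * (1 - koebe_inv_fps)"
proof -
  define w where "w = koebe_inv_fps"
  define D where "D = fps_deriv w"
  have w: "w = fps_X * (1 - w)\<^sup>2"
    using koebe_inv_fps_eq by (simp add: w_def)
  have D: "D = (1 - w)\<^sup>2 - 2 * fps_X * (1 - w) * D"
    unfolding D_def by (subst w) (simp add: power2_eq_square algebra_simps)
  \<comment> \<open>Multiplying the differentiated equation by X(1 - w) makes X(1 - w)^2 appear in
    both terms on the right, where it collapses to w.\<close>
  have "fps_X * (1 - w) * D = fps_X * (1 - w)\<^sup>2 * (1 - w) - 2 * (fps_X * (1 - w)\<^sup>2) * (fps_X * D)"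
    by (subst D) (simp add: power2_eq_square algebra_simps)
  then have "fps_X * (1 - w) * D = w * (1 - w) - 2 * w * (fps_X * D)"
    by (simp only: w[symmetric])
  then show ?thesis
    unfolding w_def[symmetric] D_def[symmetric] by (simp add: algebra_simps)
qed

definition koebe_inv_coeff :: "nat \<Rightarrow> nat \<Rightarrow> complex" where
  "koebe_inv_coeff k j = fps_nth (koebe_inv_fps ^ k) j"

lemma fps_nth_X_deriv: "fps_nth (fps_X * fps_deriv f) n = of_nat n * fps_nth f n"
  for f :: "'a::comm_semiring_1 fps"
  by (cases n) auto

text \<open>Let E = X d/dX, which multiplies the j-th coefficient by j. Then E(w^k)/k = w^(k-1)
  E(w), so E(w^k)/k + E(w^(k+1))/(k+1) = w^(k-1) (1 + w) E(w), which is w^k - w^(k+1) by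
  \<open>koebe_inv_fps_ode\<close>.\<close>

lemma koebe_inv_coeff_rec:
  assumes "k \<ge> 1"
  shows "koebe_inv_coeff (Suc k) j - koebe_inv_coeff k j =
    - (of_nat j * (koebe_inv_coeff k j / of_nat k + koebe_inv_coeff (Suc k) j / of_nat (Suc k)))"
proof -
  define w where "w = koebe_inv_fps"
  have theta: "fps_const (1 / of_nat (Suc m)) * (fps_X * fps_deriv (w ^ Suc m))
      = fps_X * fps_deriv w * w ^ m" for m
  proof -
    have "fps_const (1 / of_nat (Suc m)) * (fps_X * fps_deriv (w ^ Suc m))
      = fps_const (1 / of_nat (Suc m)) * fps_const (of_nat (Suc m)) * (fps_X * fps_deriv w * w ^ m)"
      unfolding fps_deriv_power by (simp only: mult_ac diff_Suc_1)
    also have "fps_const (1 / of_nat (Suc m)) * fps_const (of_nat (Suc m)) = (1 :: complex fps)"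
      by (simp del: of_nat_Suc)
    finally show ?thesis by simp
  qed
  obtain m where k: "k = Suc m"
    using assms by (cases k) auto
  have "fps_const (1 / of_nat k) * (fps_X * fps_deriv (w ^ k))
      + fps_const (1 / of_nat (Suc k)) * (fps_X * fps_deriv (w ^ Suc k))
      = (fps_X * fps_deriv w * (1 + w)) * w ^ m"
    unfolding theta k by (simp add: algebra_simps)
  also have "\<dots> = w ^ k - w ^ Suc k"
    using koebe_inv_fps_ode[folded w_def] by (simp add: k mult_ac right_diff_distrib)
  finally have "fps_nth (w ^ k - w ^ Suc k) j
      = 1 / of_nat k * fps_nth (fps_X * fps_deriv (w ^ k)) j
        + 1 / of_nat (Suc k) * fps_nth (fps_X * fps_deriv (w ^ Suc k)) j"
    by (metis fps_add_nth fps_mult_left_const_nth)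
  then show ?thesis
    unfolding fps_nth_X_deriv by (simp add: koebe_inv_coeff_def w_def algebra_simps)
qed

text \<open>Splitting off X^k exposes the order of vanishing of w^k and its leading
  coefficient.\<close>

lemma koebe_inv_fps_power: "koebe_inv_fps ^ k = fps_X ^ k * ((1 - koebe_inv_fps)\<^sup>2) ^ k"
  by (subst koebe_inv_fps_eq) (rule power_mult_distrib)

lemma koebe_inv_coeff_less: "j < k \<Longrightarrow> koebe_inv_coeff k j = 0"
  by (simp add: koebe_inv_coeff_def koebe_inv_fps_power fps_X_power_mult_nth)

lemma koebe_inv_coeff_same: "koebe_inv_coeff k k = 1"
proof -
  have "fps_nth koebe_inv_fps 0 = 0"
    by (subst koebe_inv_fps_eq) simp
  then show ?thesis
    by (simp add: koebe_inv_coeff_def koebe_inv_fps_power fps_X_power_mult_nth fps_power_zeroth)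
qed

lemma koebe_inv_coeff_closed:
  assumes "1 \<le> k" "k \<le> j"
  shows "koebe_inv_coeff k j =
    (-1) ^ (j + k) * (2 * of_nat k / of_nat (j + k)) * of_nat ((2 * j - 1) choose (j - k))"
  using assms(2,1)
proof (induction rule: inc_induct)
  case base
  then show ?case by (simp add: koebe_inv_coeff_same)
next
  case (step n)
  have "1 \<le> n" using step by simp
  \<comment> \<open>\<open>d\<close> is the lower binomial index in the induction hypothesis; the
    one wanted for \<open>n\<close> is \<open>Suc d\<close>.\<close>
  define d where "d = j - Suc n"
  have j: "j = Suc n + d" using step by (simp add: d_def)
  define N where "N = 2 * j - 1"
  have "Suc d * (N choose Suc d) = (N - d) * (N choose d)"
    by (metis binomial_absorb_comp binomial_absorption)
  also have "N - d = j + n"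
    using j by (simp add: N_def)
  finally have "of_nat (Suc d) * of_nat (N choose Suc d)
      = (of_nat (j + n) * of_nat (N choose d) :: complex)"
    by (metis of_nat_mult)
  then have B: "of_nat (N choose d) / of_nat (Suc d)
      = (of_nat (N choose Suc d) / of_nat (j + n) :: complex)"
    using step by (simp add: frac_eq_eq mult_ac del: of_nat_Suc of_nat_add)
  have n: "(of_nat n :: complex) \<noteq> 0" "(of_nat (Suc d) :: complex) \<noteq> 0"
      "(of_nat (Suc n) :: complex) \<noteq> 0" "(of_nat (j + Suc n) :: complex) \<noteq> 0"
    using step by (simp_all del: of_nat_Suc of_nat_add)
  \<comment> \<open>The recurrence is solved for the coefficient with the smaller power; its factor
    j/n - 1 = (d + 1)/n is nonzero because n < j.\<close>
  have "koebe_inv_coeff n j * (of_nat j / of_nat n - 1)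
      = - (koebe_inv_coeff (Suc n) j * (1 + of_nat j / of_nat (Suc n)))"
    using koebe_inv_coeff_rec[OF \<open>1 \<le> n\<close>, of j] by (simp add: algebra_simps)
  also have "of_nat j / of_nat n - 1 = of_nat (Suc d) / (of_nat n :: complex)"
    using n j by (simp add: field_simps)
  also have "1 + of_nat j / of_nat (Suc n) = of_nat (j + Suc n) / (of_nat (Suc n) :: complex)"
    using n by (simp add: field_simps)
  finally have "koebe_inv_coeff n j
      = - (of_nat n / of_nat (Suc d)) * (koebe_inv_coeff (Suc n) j * (of_nat (j + Suc n) / of_nat (Suc n)))"
    using n by (simp only: nonzero_eq_divide_eq[symmetric] divide_eq_0_iff simp_thms) (simp add: mult_ac)
  also have "koebe_inv_coeff (Suc n) j * (of_nat (j + Suc n) / of_nat (Suc n)) 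
      = (-1) ^ (j + Suc n) * 2 * of_nat (N choose d)"
    using n step.IH step by (simp add: d_def N_def del: of_nat_Suc of_nat_add)
  also have "- (of_nat n / of_nat (Suc d)) * ((-1) ^ (j + Suc n) * 2 * of_nat (N choose d))
      = (-1) ^ (j + n) * 2 * of_nat n * (of_nat (N choose d) / of_nat (Suc d) :: complex)"
    by (simp del: of_nat_Suc)
  also have "\<dots> = (-1) ^ (j + n) * (2 * of_nat n / of_nat (j + n)) * of_nat (N choose (j - n))"
    unfolding B using j by simp
  finally show ?case
    by (simp add: N_def)
qed

section \<open>The generating function as a power series in z\<close>

definition koebe_fps :: "complex fps" where
  "koebe_fps = Abs_fps of_nat"

lemma koebe_holomorphic: "koebe holomorphic_on ball 0 1"
  unfolding koebe_def by (intro holomorphic_intros) auto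

text \<open>Two multiplications by 1 - X reduce the coefficients n to 1 and then to the series X.
  The true expansion satisfies the same equation, and (1 - X)^2 can be cancelled.\<close>

lemma koebe_has_fps: "koebe has_fps_expansion koebe_fps"
proof -
  have "koebe_fps * (1 - fps_X) = Abs_fps (\<lambda>n. if n = 0 then 0 else 1)"
  proof (rule fps_ext)
    show "fps_nth (koebe_fps * (1 - fps_X)) n
        = fps_nth (Abs_fps (\<lambda>n. if n = 0 then 0 else 1)) n" for n
      by (cases n) (simp_all add: koebe_fps_def right_diff_distrib)
  qed
  moreover have "Abs_fps (\<lambda>n. if n = 0 then 0 else 1) * (1 - fps_X) = (fps_X :: complex fps)"
  proof (rule fps_ext)
    show "fps_nth (Abs_fps (\<lambda>n. if n = 0 then 0 else 1) * (1 - fps_X)) n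
        = fps_nth (fps_X :: complex fps) n" for n
      by (cases n) (simp_all add: right_diff_distrib)
  qed
  ultimately have eq: "koebe_fps * (1 - fps_X)\<^sup>2 = fps_X"
    by (simp add: power2_eq_square flip: mult.assoc)
  define F where "F = fps_expansion koebe 0"
  have F: "koebe has_fps_expansion F"
    unfolding F_def using has_fps_expansion_fps_expansion[OF _ _ koebe_holomorphic] by simp
  have "(\<lambda>z. koebe z * (1 - z)\<^sup>2) has_fps_expansion F * (1 - fps_X)\<^sup>2"
    by (intro fps_expansion_intros F)
  moreover have "eventually (\<lambda>z::complex. koebe z * (1 - z)\<^sup>2 = z) (nhds 0)"
  proof -
    have "eventually (\<lambda>z::complex. z \<in> ball 0 1) (nhds 0)"
      by (intro eventually_nhds_in_open) auto
    then show ?thesis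
      by eventually_elim (auto simp: koebe_def)
  qed
  ultimately have "(\<lambda>z. z) has_fps_expansion F * (1 - fps_X)\<^sup>2"
    using has_fps_expansion_cong[THEN iffD1, OF _ refl] by metis
  then have "F * (1 - fps_X)\<^sup>2 = koebe_fps * (1 - fps_X)\<^sup>2"
    using eq has_fps_expansion_fps_X fps_expansion_unique_complex by metis
  moreover have "(1 - fps_X :: complex fps)\<^sup>2 \<noteq> 0"
  proof -
    have "fps_nth ((1 - fps_X :: complex fps)\<^sup>2) 0 \<noteq> fps_nth 0 0"
      by (simp add: fps_power_zeroth)
    then show ?thesis by metis
  qed
  ultimately show ?thesis
    using F by simp
qed

text \<open>The formal counterpart of substituting u = K(z) into u w(ru)^k, where \<open>r\<close>
  stands for e^(-t).\<close>

definition gen_fps :: "nat \<Rightarrow> real \<Rightarrow> complex fps" where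
  "gen_fps k r = (fps_X * (koebe_inv_fps ^ k oo (fps_const (of_real r) * fps_X))) oo koebe_fps"

lemma gen_has_fps:
  "(\<lambda>z. koebe z * koebe_inv (of_real r * koebe z) ^ k) has_fps_expansion gen_fps k r"
proof -
  have "((\<lambda>u. koebe_inv u ^ k) \<circ> (\<lambda>u. of_real r * u)) has_fps_expansion
      (koebe_inv_fps ^ k oo (fps_const (of_real r) * fps_X))"
    by (rule has_fps_expansion_compose) (intro fps_expansion_intros koebe_inv_has_fps | simp)+
  then have "(\<lambda>u. u * ((\<lambda>u. koebe_inv u ^ k) \<circ> (\<lambda>u. of_real r * u)) u) has_fps_expansion
      fps_X * (koebe_inv_fps ^ k oo (fps_const (of_real r) * fps_X))"
    by (intro has_fps_expansion_mult has_fps_expansion_fps_X)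
  then have "((\<lambda>u. u * ((\<lambda>u. koebe_inv u ^ k) \<circ> (\<lambda>u. of_real r * u)) u) \<circ> koebe) has_fps_expansion
      gen_fps k r"
    unfolding gen_fps_def
    by (rule has_fps_expansion_compose[OF _ koebe_has_fps]) (simp add: koebe_fps_def)
  then show ?thesis
    by (simp add: o_def)
qed

text \<open>Since K^(j+1) starts with z^(j+1), each coefficient is a polynomial in \<open>r\<close>,
  hence a finite sum of exponentials in t. The factor X shifts the outer index by one.\<close>

lemma gen_fps_nth:
  "fps_nth (gen_fps k r) (Suc n)
    = (\<Sum>j\<le>n. koebe_inv_coeff k j * fps_nth (koebe_fps ^ Suc j) (Suc n) * of_real r ^ j)"
  unfolding gen_fps_def fps_compose_nth atLeast0AtMost sum.atMost_Suc_shift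
  by (simp add: koebe_inv_coeff_def del: power_Suc) (simp only: mult_ac)

lemma gen_fps_nth_le:
  assumes "n \<le> k"
  shows "fps_nth (gen_fps k r) n = 0"
proof (cases n)
  case 0
  then show ?thesis by (simp add: gen_fps_def)
next
  case (Suc m)
  then show ?thesis
    using assms by (auto simp: gen_fps_nth koebe_inv_coeff_less intro!: sum.neutral simp del: power_Suc)
qed

text \<open>The expansion is known only near 0, but starlikeness of the slit plane makes the
  function holomorphic on the whole disk, so the series converges to it there.\<close>

lemma gen_sums:
  assumes "z \<in> ball 0 1" "0 \<le> r" "r \<le> 1"
  shows "(\<lambda>n. fps_nth (gen_fps k r) n * z ^ n) sums (koebe z * koebe_inv (of_real r * koebe z) ^ k)"
proof (rule has_fps_expansion_imp_sums_complex[OF gen_has_fps, where r = 1])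
  have "koebe_inv \<circ> (\<lambda>z. of_real r * koebe z) holomorphic_on ball 0 1"
    using koebe_in_koebe_dom koebe_dom_scale assms
    by (intro holomorphic_on_compose_gen[OF _ koebe_inv_holomorphic] holomorphic_intros
          koebe_holomorphic) auto
  then have "(\<lambda>z. koebe z * koebe_inv (of_real r * koebe z) ^ k) holomorphic_on ball 0 1"
    by (intro holomorphic_intros koebe_holomorphic) (simp add: o_def)
  then show "(\<lambda>z. koebe z * koebe_inv (of_real r * koebe z) ^ k) holomorphic_on eball 0 1"
    by (simp add: one_ereal_def)
qed (use assms in \<open>simp add: one_ereal_def\<close>)

text \<open>At r = 1, that is t = 0, the function is K(z) z^k; its coefficients are the initial
  values.\<close>

lemma gen_fps_1:
  assumes "k \<le> Suc n"
  shows "fps_nth (gen_fps k 1) (Suc n) = of_nat (Suc n - k)"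
proof -
  have "eventually (\<lambda>z::complex. z \<in> ball 0 1) (nhds 0)"
    by (intro eventually_nhds_in_open) auto
  then have "eventually (\<lambda>z. koebe z * koebe_inv (of_real 1 * koebe z) ^ k = koebe z * z ^ k) (nhds 0)"
    by eventually_elim (simp add: koebe_inv_koebe)
  then have "(\<lambda>z. koebe z * z ^ k) has_fps_expansion gen_fps k 1"
    by (rule has_fps_expansion_cong[THEN iffD1, OF _ refl gen_has_fps[of 1 k]])
  moreover have "(\<lambda>z. koebe z * z ^ k) has_fps_expansion koebe_fps * fps_X ^ k"
    by (intro fps_expansion_intros koebe_has_fps)
  ultimately have "gen_fps k 1 = koebe_fps * fps_X ^ k"
    using fps_expansion_unique_complex by blast
  then show ?thesis
    using assms by (simp add: fps_X_power_mult_right_nth koebe_fps_def del: of_nat_Suc)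
qed

section \<open>Identification of the de Branges functions\<close>

lemma koebe_fps_power_Reals: "fps_nth (koebe_fps ^ m) n \<in> \<real>"
proof (induction m arbitrary: n)
  case 0
  then show ?case by simp
next
  case (Suc m)
  then show ?case
    by (simp add: fps_mult_nth koebe_fps_def)
qed

lemma koebe_inv_coeff_Reals:
  assumes "k \<ge> 1"
  shows "koebe_inv_coeff k j \<in> \<real>"
proof (cases "k \<le> j")
  case True
  then show ?thesis
    unfolding koebe_inv_coeff_closed[OF assms True] by (intro Reals_mult Reals_divide) auto
qed (simp add: koebe_inv_coeff_less)

text \<open>For k \<ge> 1 both factors are real, so \<open>Re\<close> only changes the type.\<close>

definition tau_coeff :: "nat \<Rightarrow> nat \<Rightarrow> nat \<Rightarrow> real" where
  "tau_coeff n k j = Re (koebe_inv_coeff k j * fps_nth (koebe_fps ^ Suc j) (Suc n))"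

definition tau :: "nat \<Rightarrow> nat \<Rightarrow> real \<Rightarrow> real" where
  "tau n k t = (\<Sum>j\<le>n. tau_coeff n k j * exp (- real j * t))"

lemma of_real_tau:
  assumes "k \<ge> 1"
  shows "of_real (tau n k t) = fps_nth (gen_fps k (exp (- t))) (Suc n)"
proof -
  have "of_real (tau_coeff n k j) = koebe_inv_coeff k j * fps_nth (koebe_fps ^ Suc j) (Suc n)" for j
    unfolding tau_coeff_def
    using koebe_inv_coeff_Reals[OF assms] koebe_fps_power_Reals by (intro of_real_Re Reals_mult)
  moreover have "exp (- real j * t) = exp (- t) ^ j" for j
    by (simp flip: exp_of_nat_mult)
  ultimately show ?thesis
    unfolding gen_fps_nth tau_def by (simp del: power_Suc)
qed

text \<open>The recurrence for \<open>koebe_inv_coeff\<close> is linear, and the factor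
  \<open>b\<close> is independent of k.\<close>

lemma tau_coeff_rec:
  assumes "k \<ge> 1"
  shows "tau_coeff n (Suc k) j - tau_coeff n k j =
    - (real j * (tau_coeff n k j / real k + tau_coeff n (Suc k) j / real (Suc k)))"
proof -
  define b where "b = fps_nth (koebe_fps ^ Suc j) (Suc n)"
  have "(koebe_inv_coeff (Suc k) j - koebe_inv_coeff k j) * b =
    - (of_nat j * (koebe_inv_coeff k j * b / of_nat k + koebe_inv_coeff (Suc k) j * b / of_nat (Suc k)))"
    unfolding koebe_inv_coeff_rec[OF assms] by (simp add: algebra_simps)
  then have "Re ((koebe_inv_coeff (Suc k) j - koebe_inv_coeff k j) * b) = Re (
    - (of_nat j * (koebe_inv_coeff k j * b / of_nat k + koebe_inv_coeff (Suc k) j * b / of_nat (Suc k))))"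
    by (rule arg_cong)
  moreover have "Re (of_nat j * w) = real j * Re w" for w
    by simp
  ultimately show ?thesis
    unfolding tau_coeff_def b_def[symmetric]
    by (simp only: left_diff_distrib minus_complex.simps uminus_complex.simps plus_complex.simps
        Re_divide_of_nat)
qed

lemma tau_system: "de_branges_system n (tau n)"
proof -
  define T' where "T' k t = (\<Sum>j\<le>n. tau_coeff n k j * (- real j * exp (- real j * t)))" for k t
  have deriv: "(tau n k has_real_derivative T' k t) (at t within {0..})" for k t
    unfolding tau_def[abs_def] T'_def by (auto intro!: derivative_eq_intros sum.cong)
  have ode: "tau n (k+1) t - tau n k t = T' k t / real k + T' (k+1) t / real (k+1)"
    if "k \<in> {1..n}" for k t
  proof -
    have "tau n (k+1) t - tau n k t
        = (\<Sum>j\<le>n. (tau_coeff n (Suc k) j - tau_coeff n k j) * exp (- real j * t))"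
      by (simp add: tau_def sum_subtractf left_diff_distrib)
    also have "\<dots> = (\<Sum>j\<le>n. tau_coeff n k j * (- real j * exp (- real j * t)) / real k +
        tau_coeff n (Suc k) j * (- real j * exp (- real j * t)) / real (Suc k))"
      using that by (intro sum.cong refl, subst tau_coeff_rec) (auto simp: algebra_simps simp del: of_nat_Suc)
    also have "\<dots> = T' k t / real k + T' (k+1) t / real (k+1)"
      by (simp add: T'_def sum_subtractf sum_negf sum_divide_distrib)
    finally show ?thesis .
  qed
  \<comment> \<open>Only j \<le> n occur, and w^(n+1) has no terms of such low order.\<close>
  have "tau n (n+1) t = 0" for t
    by (simp add: tau_def tau_coeff_def koebe_inv_coeff_less)
  moreover have "tau n k 0 = real n + 1 - real k" if "k \<in> {1..n+1}" for k
  proof -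
    have "complex_of_real (tau n k 0) = of_real (real n + 1 - real k)"
      using that gen_fps_1[of k n] by (simp add: of_real_tau)
    then show ?thesis
      by (simp only: of_real_eq_iff)
  qed
  ultimately show ?thesis
    unfolding de_branges_system_def using deriv ode by blast
qed

text \<open>Downward induction on k from the zero function at n + 1. Once two solutions agree at m +
  1, their difference f at m satisfies f' = -m f and f(0) = 0.\<close>

lemma de_branges_system_unique:
  assumes T: "de_branges_system n T" and S: "de_branges_system n S"
    and "k \<in> {1..n+1}" "t \<ge> 0"
  shows "T k t = S k t"
proof -
  from T obtain T' where
    "(\<forall>k\<in>{1..n+1}. \<forall>t\<ge>0. (T k has_real_derivative T' k t) (at t within {0..})) \<and>
     (\<forall>k\<in>{1..n}. \<forall>t\<ge>0. T (k+1) t - T k t = T' k t / real k + T' (k+1) t / real (k+1))"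
    unfolding de_branges_system_def by (elim conjE exE) (rule that, rule conjI)
  then have T': "\<And>k t. k \<in> {1..n+1} \<Longrightarrow> t \<ge> 0 \<Longrightarrow> (T k has_real_derivative T' k t) (at t within {0..})"
      "\<And>k t. k \<in> {1..n} \<Longrightarrow> t \<ge> 0 \<Longrightarrow> T (k+1) t - T k t = T' k t / real k + T' (k+1) t / real (k+1)"
    by blast+
  from S obtain S' where
    "(\<forall>k\<in>{1..n+1}. \<forall>t\<ge>0. (S k has_real_derivative S' k t) (at t within {0..})) \<and>
     (\<forall>k\<in>{1..n}. \<forall>t\<ge>0. S (k+1) t - S k t = S' k t / real k + S' (k+1) t / real (k+1))"
    unfolding de_branges_system_def by (elim conjE exE) (rule that, rule conjI)
  then have S': "\<And>k t. k \<in> {1..n+1} \<Longrightarrow> t \<ge> 0 \<Longrightarrow> (S k has_real_derivative S' k t) (at t within {0..})"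
      "\<And>k t. k \<in> {1..n} \<Longrightarrow> t \<ge> 0 \<Longrightarrow> S (k+1) t - S k t = S' k t / real k + S' (k+1) t / real (k+1)"
    by blast+
  have "k \<le> n + 1" using assms by simp
  then have "1 \<le> k \<Longrightarrow> (\<forall>t\<ge>0. T k t = S k t)"
  proof (induction rule: inc_induct)
    case base
    show ?case using S T by (simp add: de_branges_system_def)
  next
    case (step m)
    have eq: "T (Suc m) t = S (Suc m) t" if "t \<ge> 0" for t
      using step that by simp
    have eq': "T' (Suc m) t = S' (Suc m) t" if "t \<ge> 0" for t
    proof -
      have "(T (Suc m) has_real_derivative S' (Suc m) t) (at t within {0..})"
        using has_field_derivative_transform_within[OF S'(1)[of "Suc m" t], of 1 "T (Suc m)"] step that eq
        by auto
      moreover have "(T (Suc m) has_real_derivative T' (Suc m) t) (at t within {0..})"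
        using T'(1) step that by simp
      \<comment> \<open>Derivatives within [0,\<infinity>) are unique because every \<open>t\<close>
        is a limit point, including the endpoint 0.\<close>
      moreover have "at t within {0..} \<noteq> bot"
        unfolding trivial_limit_within islimpt_approachable not_not
      proof (intro allI impI)
        fix e :: real assume "e > 0"
        then show "\<exists>s\<in>{0..}. s \<noteq> t \<and> dist s t < e"
          using that by (intro bexI[of _ "t + e / 2"]) (auto simp: dist_real_def)
      qed
      ultimately show ?thesis
        using vector_derivative_unique_within
        by (metis has_real_derivative_iff_has_vector_derivative)
    qed
    \<comment> \<open>The integrating factor e^(mt) turns f' = -m f into a vanishing
      derivative.\<close>
    define D where "D t = (T m t - S m t) * exp (real m * t)" for t
    have "(D has_real_derivative 0) (at t within {0..})" if "t \<in> {0..}" for t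
    proof -
      have "T (Suc m) t - T m t = T' m t / real m + T' (Suc m) t / real (Suc m)"
        "S (Suc m) t - S m t = S' m t / real m + S' (Suc m) t / real (Suc m)"
        using T'(2)[of m t] S'(2)[of m t] step that by auto
      then have "T' m t / real m - S' m t / real m = - (T m t - S m t)"
        using eq[of t] eq'[of t] that by simp
      then have "T' m t - S' m t = - real m * (T m t - S m t)"
        using step by (simp add: field_simps)
      moreover have "(D has_real_derivative (T' m t - S' m t) * exp (real m * t)
          + (exp (real m * t) * real m) * (T m t - S m t)) (at t within {0..})"
        unfolding D_def using T'(1)[of m t] S'(1)[of m t] step that
        by (auto intro!: derivative_eq_intros)
      ultimately show ?thesis by simp
    qed
    then obtain c where c: "\<And>t. t \<ge> 0 \<Longrightarrow> D t = c"
      using has_field_derivative_zero_constant[of "{0::real..}" D] by auto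
    have "D 0 = 0"
      using T S step by (simp add: D_def de_branges_system_def)
    then have "D t = 0" if "t \<ge> 0" for t
      using c[of 0] c[of t] that by simp
    then show ?case
      by (simp add: D_def)
  qed
  then show ?thesis
    using assms by simp
qed

lemma de_branges_eq_tau:
  assumes "k \<in> {1..n+1}" "t \<ge> 0"
  shows "de_branges n k t = tau n k t"
  unfolding de_branges_def
  using de_branges_system_unique[OF _ tau_system assms] tau_system by (intro the_equality) auto

lemma de_branges_term_sums:
  assumes "k \<ge> 1" "t \<ge> 0" "z \<in> ball 0 1"
  shows "(\<lambda>i. de_branges_term k z t (i + k)) sums
    (koebe z * koebe_inv (of_real (exp (- t)) * koebe z) ^ k)"
proof -
  have "(\<lambda>n. fps_nth (gen_fps k (exp (- t))) n * z ^ n) sums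
      (koebe z * koebe_inv (of_real (exp (- t)) * koebe z) ^ k)"
    using assms by (intro gen_sums) auto
  \<comment> \<open>The term with index \<open>i + k\<close> carries the power i + k + 1 of z, so
    \<open>Suc k\<close> vanishing coefficients are dropped.\<close>
  moreover have "(\<Sum>n<Suc k. fps_nth (gen_fps k (exp (- t))) n * z ^ n) = 0"
    by (intro sum.neutral) (auto simp: gen_fps_nth_le)
  ultimately have "(\<lambda>i. fps_nth (gen_fps k (exp (- t))) (i + Suc k) * z ^ (i + Suc k)) sums
      (koebe z * koebe_inv (of_real (exp (- t)) * koebe z) ^ k)"
    by (subst sums_iff_shift) simp
  moreover have "de_branges_term k z t (i + k)
      = fps_nth (gen_fps k (exp (- t))) (i + Suc k) * z ^ (i + Suc k)" for i
    using assms by (simp add: de_branges_term_def de_branges_eq_tau of_real_tau)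
  ultimately show ?thesis by simp
qed

section \<open>The square-root representation\<close>

text \<open>The quotient f/g is continuous with values in {1, -1}, hence constant on a connected
  set, and it is 1 at \<open>a\<close>.\<close>

lemma connected_sqrt_unique:
  fixes f g :: "'a::topological_space \<Rightarrow> complex"
  assumes "connected S" "continuous_on S f" "continuous_on S g"
    and "\<And>u. u \<in> S \<Longrightarrow> (f u)\<^sup>2 = (g u)\<^sup>2" "\<And>u. u \<in> S \<Longrightarrow> g u \<noteq> 0"
    and "a \<in> S" "f a = g a" "z \<in> S"
  shows "f z = g z"
proof -
  have "f u / g u \<in> {1, -1}" if "u \<in> S" for u
  proof -
    have "f u = g u \<or> f u = - g u"
      using assms(4)[OF that] by (simp add: power2_eq_iff)
    then show ?thesis
      using assms(5)[OF that] by auto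
  qed
  then have "(\<lambda>u. f u / g u) ` S \<subseteq> {1, -1}"
    by blast
  then have "finite ((\<lambda>u. f u / g u) ` S)"
    by (rule finite_subset) simp
  then have "(\<lambda>u. f u / g u) constant_on S"
    using assms by (intro continuous_finite_range_constant continuous_intros) auto
  then have "f z / g z = f a / g a"
    using assms unfolding constant_on_def by metis
  then show ?thesis
    using assms by simp
qed

text \<open>
  With \<open>x = 1 - 2y\<close> one has \<open>1 - 2xz + z\<^sup>2 = (1 - z)\<^sup>2 (1 + 4 y K(z))\<close>.
\<close>

lemma legendre_sqrt_eq:
  assumes "0 \<le> y" "y \<le> 1" "z \<in> ball 0 1"
  shows "legendre_sqrt (1 - 2 * y) z = (1 - z) * csqrt (1 + 4 * (of_real y * koebe z))"
proof -
  define r where "r z = (1 - z) * csqrt (1 + 4 * (of_real y * koebe z))" for z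
  have dom: "of_real y * koebe u \<in> koebe_dom" if "u \<in> ball 0 1" for u
    using koebe_dom_scale koebe_in_koebe_dom assms that by blast
  have hol: "r holomorphic_on ball 0 1"
    unfolding r_def using dom
    by (intro holomorphic_intros koebe_holomorphic) (auto simp: koebe_dom_def)
  have sq: "(r u)\<^sup>2 = 1 - 2 * of_real (1 - 2 * y) * u + u\<^sup>2" if "u \<in> ball 0 1" for u
  proof -
    have "1 - u \<noteq> 0" using that by auto
    then have "(1 - u)\<^sup>2 * (1 + 4 * (of_real y * koebe u)) = (1 - u)\<^sup>2 + 4 * of_real y * u"
      by (simp add: koebe_def distrib_left)
    then show ?thesis
      by (simp add: r_def power_mult_distrib) (simp add: power2_eq_square algebra_simps)
  qed
  have nz: "r u \<noteq> 0" if "u \<in> ball 0 1" for u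
    using that dom[OF that] by (auto simp: r_def koebe_dom_def)
  have r0: "r 0 = 1"
    by (simp add: r_def koebe_def)
  \<comment> \<open>Any other admissible branch has the same square and the same value at 0, and
    \<open>r\<close> has no zeros in the disk.\<close>
  have "q z = r z" if "q holomorphic_on ball 0 1" "q 0 = 1"
      "\<forall>u\<in>ball 0 1. (q u)\<^sup>2 = 1 - 2 * of_real (1 - 2 * y) * u + u\<^sup>2" for q
    by (rule connected_sqrt_unique[of "ball 0 1" q r 0])
      (use that hol sq nz r0 assms in \<open>auto intro: holomorphic_on_imp_continuous_on\<close>)
  then show ?thesis
    unfolding legendre_sqrt_def r_def[symmetric] using hol sq r0 by (intro the_equality) blast+
qed

text \<open>The denominator (1 - z)^2 of K(z) is absorbed into (1 + s)^2.\<close>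

lemma koebe_inv_legendre:
  assumes "0 \<le> y" "y \<le> 1" "z \<in> ball 0 1"
  shows "koebe_inv (of_real y * koebe z)
    = 4 * of_real y * z / (1 - z + legendre_sqrt (1 - 2 * y) z)\<^sup>2"
proof -
  define s where "s = csqrt (1 + 4 * (of_real y * koebe z))"
  have "1 - z \<noteq> 0" using assms by auto
  have "of_real y * koebe z \<in> koebe_dom"
    using koebe_dom_scale koebe_in_koebe_dom assms by blast
  then have "koebe_inv (of_real y * koebe z) = 4 * (of_real y * (z / (1 - z)\<^sup>2)) / (1 + s)\<^sup>2"
    by (simp add: koebe_inv_eq s_def koebe_def)
  also have "\<dots> = 4 * of_real y * z / ((1 - z) * (1 + s))\<^sup>2"
    by (simp add: power_mult_distrib mult_ac)
  also have "(1 - z) * (1 + s) = 1 - z + legendre_sqrt (1 - 2 * y) z"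
    using assms by (simp add: legendre_sqrt_eq s_def distrib_left)
  finally show ?thesis .
qed

section \<open>Series of powers of the inverse and the hypergeometric function\<close>

text \<open>The radius 1/4 is the distance from 0 to the branch point -1/4.\<close>

lemma koebe_inv_power_sums:
  assumes "norm (4 * u) < 1"
  shows "(\<lambda>j. koebe_inv_coeff k j * u ^ j) sums (koebe_inv u ^ k)"
  unfolding koebe_inv_coeff_def
proof (rule has_fps_expansion_imp_sums_complex[where r = "ereal (1 / 4)"])
  show "(\<lambda>u. koebe_inv u ^ k) has_fps_expansion koebe_inv_fps ^ k"
    by (intro fps_expansion_intros koebe_inv_has_fps)
  have "koebe_inv holomorphic_on ball 0 (1 / 4)"
    by (rule holomorphic_on_subset[OF koebe_inv_holomorphic])
      (auto intro!: ball_subset_koebe_dom simp: norm_mult)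
  then show "(\<lambda>u. koebe_inv u ^ k) holomorphic_on eball 0 (ereal (1 / 4))"
    by (auto intro!: holomorphic_intros)
qed (use assms in \<open>simp add: norm_mult\<close>)

lemma koebe_inv_power_sums_shift:
  assumes "norm (4 * u) < 1"
  shows "(\<lambda>i. koebe_inv_coeff k (i + k) * u ^ (i + k)) sums (koebe_inv u ^ k)"
  using koebe_inv_power_sums[OF assms, of k]
  by (subst sums_iff_shift) (simp add: koebe_inv_coeff_less)

text \<open>The duplication formula merges (k)_m (k + 1/2)_m into 4^(-m) (2k)_(2m), a quotient of
  factorials that matches the binomial closed form.\<close>

lemma koebe_inv_coeff_pochhammer:
  assumes "k \<ge> 1"
  shows "koebe_inv_coeff k (m + k) = pochhammer (of_nat k) m * pochhammer (of_nat k + 1 / 2) m /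
    (pochhammer (2 * of_nat k + 1) m * fact m) * (- 4) ^ m"
proof -
  \<comment> \<open>Chosen so that \<open>a + 2 * m\<close> is the upper binomial index 2(m + k) -
    1.\<close>
  define a where "a = 2 * k - 1"
  have k: "2 * k = Suc a" using assms by (simp add: a_def)
  have num: "4 ^ m * (pochhammer (of_nat k) m * pochhammer (of_nat k + 1 / 2) m)
      = (fact (a + 2 * m) / fact a :: complex)"
  proof -
    have "pochhammer 1 (a + 2 * m) = pochhammer 1 a * pochhammer (1 + of_nat a :: complex) (2 * m)"
      by (rule pochhammer_product')
    moreover have "(1 + of_nat a :: complex) = 2 * of_nat k"
      by (metis k of_nat_Suc of_nat_mult of_nat_numeral)
    ultimately have "fact (a + 2 * m) = fact a * pochhammer (2 * of_nat k :: complex) (2 * m)"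
      by (simp add: pochhammer_fact)
    moreover have "4 ^ m * (pochhammer (of_nat k) m * pochhammer (of_nat k + 1 / 2) m)
        = pochhammer (2 * of_nat k :: complex) (2 * m)"
      unfolding pochhammer_double by (simp add: power_mult)
    ultimately show ?thesis
      by simp
  qed
  have den: "pochhammer (2 * of_nat k + 1) m = (fact (2 * k + m) / fact (2 * k) :: complex)"
  proof -
    have "pochhammer 1 (2 * k + m) = pochhammer 1 (2 * k) * pochhammer (1 + of_nat (2 * k) :: complex) m"
      by (rule pochhammer_product')
    then show ?thesis
      by (simp add: add.commute flip: pochhammer_fact)
  qed
  have binom: "of_nat ((2 * (m + k) - 1) choose (m + k - k))
      = (fact (a + 2 * m) / (fact m * fact (a + m)) :: complex)"
  proof -
    have e: "2 * (m + k) - 1 = a + 2 * m" using assms by (simp add: a_def)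
    show ?thesis
      unfolding e by (subst binomial_fact) (simp_all add: add.commute)
  qed
  have index: "m + k + k = 2 * k + m" by simp
  have sign: "(-1 :: complex) ^ (2 * k + m) = (-1) ^ m"
    by (simp add: power_add)
  have "fact (2 * k + m) = (of_nat (2 * k + m) * fact (a + m) :: complex)"
      "fact (2 * k) = (of_nat (2 * k) * fact a :: complex)"
    unfolding k by simp_all
  then have "koebe_inv_coeff k (m + k) = (-1) ^ m * (fact (a + 2 * m) / fact a) /
      (fact (2 * k + m) / fact (2 * k) * fact m)"
    unfolding koebe_inv_coeff_closed[OF assms le_add2] binom index sign by (simp add: mult_ac)
  also have "(-1) ^ m * (fact (a + 2 * m) / fact a)
      = pochhammer (of_nat k) m * pochhammer (of_nat k + 1 / 2) m * (- 4 :: complex) ^ m"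
    unfolding num[symmetric] by (simp add: mult_ac flip: power_mult_distrib)
  finally show ?thesis
    unfolding den by simp
qed

lemma connected_slit_plane: "connected (- (complex_of_real ` {1..}))"
proof (intro starlike_imp_connected, unfold starlike_def, intro bexI ballI)
  show "0 \<in> - (complex_of_real ` {1..})"
    by auto
  show "closed_segment 0 v \<subseteq> - (complex_of_real ` {1..})" if v: "v \<in> - (complex_of_real ` {1..})" for v
  proof
    fix u assume "u \<in> closed_segment 0 v"
    then obtain r where r: "0 \<le> r" "r \<le> 1" "u = r *\<^sub>R v"
      by (auto simp: in_segment)
    show "u \<in> - (complex_of_real ` {1..})"
    proof
      assume "u \<in> complex_of_real ` {1..}"
      then obtain x where x: "x \<ge> 1" "r *\<^sub>R v = of_real x"
        using r by auto
      then have "r > 0" using r by (cases "r = 0") auto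
      then have "v = of_real (x / r)"
        using x by (simp add: scaleR_conv_of_real field_simps)
      moreover have "x / r \<ge> 1"
        using x r \<open>r > 0\<close> by (simp add: field_simps)
      ultimately show False using v by blast
    qed
  qed
qed

lemma open_slit_plane: "open (- (complex_of_real ` {1..}))"
proof -
  have "- (complex_of_real ` {1..}) = - (\<real> \<inter> {v. Re v \<ge> 1})"
    by (auto elim!: Reals_cases)
  then show ?thesis
    by (metis closed_Int closed_complex_Reals closed_halfspace_Re_ge open_Compl)
qed

text \<open>Two continuations agree on the unit disk, hence on the open connected slit plane by the
  identity theorem.\<close>

lemma hyp2F1_eqI:
  assumes F: "F holomorphic_on - (complex_of_real ` {1..})"
    and sums: "\<And>s. s \<in> ball 0 1 \<Longrightarrow>
      (\<lambda>m. pochhammer a m * pochhammer b m / (pochhammer c m * fact m) * s ^ m) sums F s"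
    and u: "u \<notin> complex_of_real ` {1..}"
  shows "hyp2F1 a b c u = F u"
proof -
  have "G u = F u" if "G holomorphic_on - (complex_of_real ` {1..})"
    "\<forall>s\<in>ball 0 1. (\<lambda>m. pochhammer a m * pochhammer b m / (pochhammer c m * fact m) * s ^ m) sums G s"
    for G
  proof (rule analytic_continuation_open[of "ball 0 1" "- (complex_of_real ` {1..})" G F])
    show "ball 0 1 \<subseteq> - (complex_of_real ` {1..})"
      by auto
    show "G s = F s" if "s \<in> ball 0 1" for s
      using that sums \<open>\<forall>s\<in>ball 0 1. _ sums G s\<close> sums_unique2 by blast
  qed (use that F u open_slit_plane connected_slit_plane in auto)
  then show ?thesis
    unfolding hyp2F1_def using F sums by (intro the_equality) blast+
qed

lemma slit_plane_iff: "v \<notin> complex_of_real ` {1..} \<longleftrightarrow> 1 - v \<notin> \<real>\<^sub>\<le>\<^sub>0"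
proof -
  have "v \<in> complex_of_real ` {1..} \<longleftrightarrow> Re v \<ge> 1 \<and> Im v = 0"
    by (auto simp: image_iff complex_eq_iff)
  then show ?thesis
    by (auto simp: complex_nonpos_Reals_iff)
qed

text \<open>
  The continuation of the hypergeometric series is \<open>(2 / (1 + \<surd>(1 - v)))\<^sup>2\<^sup>k\<close>, since
  \<open>koebe_inv u = 4u / (1 + \<surd>(1 + 4u))\<^sup>2\<close>.
\<close>

lemma hyp2F1_koebe_inv:
  assumes "k \<ge> 1" "u \<in> koebe_dom"
  shows "u ^ k * hyp2F1 (of_nat k) (of_nat k + 1 / 2) (2 * of_nat k + 1) (- 4 * u) = koebe_inv u ^ k"
proof -
  define F where "F v = (4 / (1 + csqrt (1 - v))\<^sup>2) ^ k" for v
  have F: "F holomorphic_on - (complex_of_real ` {1..})"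
    unfolding F_def using one_plus_csqrt_neq_0 slit_plane_iff
    by (intro holomorphic_intros) auto
  have koebe_F: "koebe_inv u ^ k = u ^ k * F (- 4 * u)" if "u \<in> koebe_dom" for u
    using koebe_inv_eq[OF that] by (simp add: F_def power_divide power_mult_distrib)
  have "(\<lambda>m. pochhammer (of_nat k) m * pochhammer (of_nat k + 1 / 2) m /
      (pochhammer (2 * of_nat k + 1) m * fact m) * s ^ m) sums F s" if s: "s \<in> ball 0 1" for s
  \<comment> \<open>The general case cancels \<open>u ^ k\<close>, so s = 0 is treated apart; there
    only the constant term 1 remains.\<close>
  proof (cases "s = 0")
    case True
    show ?thesis unfolding True powser_sums_zero_iff by (simp add: F_def)
  next
    case False
    define u where "u = - s / 4"
    have u: "norm (4 * u) < 1" "u \<noteq> 0" "s = - 4 * u"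
      using s False by (auto simp: u_def)
    have "(\<lambda>m. u ^ k * (pochhammer (of_nat k) m * pochhammer (of_nat k + 1 / 2) m /
      (pochhammer (2 * of_nat k + 1) m * fact m) * s ^ m)) sums (u ^ k * F s)"
      using koebe_inv_power_sums_shift[OF u(1), of k] ball_subset_koebe_dom[OF u(1)] koebe_F
      unfolding u(3) koebe_inv_coeff_pochhammer[OF assms(1)] power_mult_distrib power_add
      by (simp add: mult_ac)
    then show ?thesis
      using u by (subst (asm) sums_mult_iff) auto
  qed
  moreover have "- 4 * u \<notin> complex_of_real ` {1..}"
    unfolding slit_plane_iff using assms by (simp add: koebe_dom_def)
  ultimately show ?thesis
    using hyp2F1_eqI[OF F] koebe_F[OF assms(2)] by simp
qed

section \<open>Taylor series in y and assembly of the representations\<close>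

lemma gen_coeff_eq:
  assumes "k \<ge> 1" "k \<le> j"
  shows "gen_coeff k z j = koebe z * (koebe_inv_coeff k j * koebe z ^ j)"
  unfolding gen_coeff_def koebe_inv_coeff_closed[OF assms] by simp

lemma de_branges_gen_eq:
  assumes "k \<ge> 1" "t \<ge> 0" "z \<in> ball 0 1"
  shows "de_branges_gen k z t = koebe z * koebe_inv (of_real (exp (- t)) * koebe z) ^ k"
  unfolding de_branges_gen_def using de_branges_term_sums[OF assms] by (rule sums_unique[symmetric])

lemma gen_coeff_sums:
  assumes "k \<ge> 1" "norm (4 * koebe z * y) < 1"
  shows "(\<lambda>i. gen_coeff k z (i + k) * y ^ (i + k)) sums (koebe z * koebe_inv (y * koebe z) ^ k)"
proof -
  have "(\<lambda>i. koebe z * (koebe_inv_coeff k (i + k) * (y * koebe z) ^ (i + k))) sums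
      (koebe z * koebe_inv (y * koebe z) ^ k)"
    using assms by (intro sums_mult koebe_inv_power_sums_shift) (simp add: mult_ac)
  then show ?thesis
    using assms by (simp add: gen_coeff_eq power_mult_distrib mult_ac)
qed

text \<open>Since y = 0 is not of the form e^(-t), the Taylor coefficients are taken from an
  extension \<open>G\<close> to complex y; its expansion is that of w^k rescaled by K(z).\<close>

lemma gen_taylor:
  fixes z :: complex
  assumes "k \<ge> 1"
  defines "G \<equiv> \<lambda>y. koebe z * koebe_inv (y * koebe z) ^ k"
  shows "G holomorphic_on {y. norm (4 * koebe z * y) < 1}"
    and "(deriv ^^ j) G 0 / fact j = (if j < k then 0 else gen_coeff k z j)"
proof -
  have "koebe_inv \<circ> (\<lambda>y. y * koebe z) holomorphic_on {y. norm (4 * koebe z * y) < 1}"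
    by (intro holomorphic_on_compose_gen[OF _ koebe_inv_holomorphic] holomorphic_intros)
      (auto intro!: ball_subset_koebe_dom simp: mult_ac)
  then show "G holomorphic_on {y. norm (4 * koebe z * y) < 1}"
    unfolding G_def by (intro holomorphic_intros) (simp add: o_def)
  have "((\<lambda>u. koebe_inv u ^ k) \<circ> (\<lambda>y. koebe z * y)) has_fps_expansion
      (koebe_inv_fps ^ k oo (fps_const (koebe z) * fps_X))"
    by (rule has_fps_expansion_compose) (intro fps_expansion_intros koebe_inv_has_fps | simp)+
  then have "(\<lambda>y. koebe z * ((\<lambda>u. koebe_inv u ^ k) \<circ> (\<lambda>y. koebe z * y)) y) has_fps_expansion
      fps_const (koebe z) * (koebe_inv_fps ^ k oo (fps_const (koebe z) * fps_X))"
    by (rule has_fps_expansion_cmult_left)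
  then have "G has_fps_expansion
      fps_const (koebe z) * (koebe_inv_fps ^ k oo (fps_const (koebe z) * fps_X))"
    by (simp add: G_def o_def mult.commute)
  from fps_nth_fps_expansion[OF this, of j]
  have "(deriv ^^ j) G 0 / fact j = koebe z * (koebe_inv_coeff k j * koebe z ^ j)"
    unfolding fps_mult_left_const_nth fps_nth_compose_linear by (simp add: koebe_inv_coeff_def mult_ac)
  then show "(deriv ^^ j) G 0 / fact j = (if j < k then 0 else gen_coeff k z j)"
    using assms by (simp add: gen_coeff_eq koebe_inv_coeff_less)
qed

theorem theorem3:
  fixes k :: nat and t x :: real and z :: complex
  assumes "k \<ge> 1" and "t \<ge> 0" and "x = 1 - 2 * exp (- t)" and "z \<in> ball 0 1"
  shows "summable (\<lambda>i. de_branges_term k z t (i + k)) \<and>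
    de_branges_gen k z t = koebe z * koebe_flow z t ^ k \<and>
    de_branges_gen k z t =
      koebe z * (4 * of_real (exp (- t)) * z / (1 - z + legendre_sqrt x z)\<^sup>2) ^ k \<and>
    de_branges_gen k z t =
      koebe z ^ (k + 1) * of_real (exp (- real k * t)) *
        hyp2F1 (of_nat k) (of_nat k + 1 / 2) (2 * of_nat k + 1)
          (- 4 * koebe z * of_real (exp (- t))) \<and>
    (norm (4 * koebe z * of_real (exp (- t))) < 1 \<longrightarrow>
      (\<lambda>i. gen_coeff k z (i + k) * of_real (exp (- real (i + k) * t)))
        sums de_branges_gen k z t) \<and>
    (\<exists>G. G holomorphic_on {y. norm (4 * koebe z * y) < 1} \<and>
      (\<forall>s\<ge>0. norm (4 * koebe z * of_real (exp (- s))) < 1 \<longrightarrow>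
        G (of_real (exp (- s))) = de_branges_gen k z s) \<and>
      (\<forall>j. (deriv ^^ j) G 0 / fact j = (if j < k then 0 else gen_coeff k z j))) \<and>
    exp (- t) = (1 - x) / 2"
proof (intro conjI impI)
  define y where "y = exp (- t)"
  define u where "u = of_real y * koebe z"
  have y: "0 \<le> y" "y \<le> 1" using assms by (auto simp: y_def)
  have y_power: "of_real (exp (- real n * t)) = (of_real y :: complex) ^ n" for n
    unfolding y_def of_real_power[symmetric] by (simp flip: exp_of_nat_mult)
  have u: "u \<in> koebe_dom"
    unfolding u_def using koebe_dom_scale koebe_in_koebe_dom y assms by blast
  have B: "de_branges_gen k z t = koebe z * koebe_inv u ^ k"
    using assms by (simp add: de_branges_gen_eq u_def y_def)
  show "summable (\<lambda>i. de_branges_term k z t (i + k))"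
    using de_branges_term_sums assms sums_summable by blast
  show "de_branges_gen k z t = koebe z * koebe_flow z t ^ k"
    unfolding B using assms by (simp add: koebe_flow_eq u_def y_def)
  show "de_branges_gen k z t =
      koebe z * (4 * of_real (exp (- t)) * z / (1 - z + legendre_sqrt x z)\<^sup>2) ^ k"
    unfolding B u_def using koebe_inv_legendre[OF y assms(4)] assms(3) by (simp add: y_def)
  show "de_branges_gen k z t =
      koebe z ^ (k + 1) * of_real (exp (- real k * t)) *
        hyp2F1 (of_nat k) (of_nat k + 1 / 2) (2 * of_nat k + 1)
          (- 4 * koebe z * of_real (exp (- t)))"
  proof -
    \<comment> \<open>The factor \<open>u ^ k\<close> in front of the hypergeometric value supplies
      K(z)^k e^(-kt).\<close>
    have e: "- 4 * koebe z * of_real (exp (- t)) = - 4 * u"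
      by (simp add: u_def y_def)
    then show ?thesis
      unfolding B hyp2F1_koebe_inv[OF assms(1) u, symmetric] y_power e
      by (simp add: u_def power_mult_distrib mult_ac)
  qed
  show "(\<lambda>i. gen_coeff k z (i + k) * of_real (exp (- real (i + k) * t))) sums de_branges_gen k z t"
    if "norm (4 * koebe z * of_real (exp (- t))) < 1"
    unfolding y_power B u_def using assms that by (intro gen_coeff_sums) (simp_all add: y_def)
  \<comment> \<open>One \<open>G\<close> serves all times \<open>s\<close>, because
    \<open>de_branges_gen_eq\<close> holds for every s \<ge> 0.\<close>
  show "\<exists>G. G holomorphic_on {y. norm (4 * koebe z * y) < 1} \<and>
      (\<forall>s\<ge>0. norm (4 * koebe z * of_real (exp (- s))) < 1 \<longrightarrow>
        G (of_real (exp (- s))) = de_branges_gen k z s) \<and>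
      (\<forall>j. (deriv ^^ j) G 0 / fact j = (if j < k then 0 else gen_coeff k z j))"
    using gen_taylor[OF assms(1)] de_branges_gen_eq assms
    by (intro exI[of _ "\<lambda>y. koebe z * koebe_inv (y * koebe z) ^ k"]) simp
  show "exp (- t) = (1 - x) / 2"
    using assms by simp
qed

end
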